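(* Let $f:X\to X$ be a continuous map of a compact smooth manifold $X$ which is minimal but not uniquely ergodic. Then the set of points $x\in X$ that are non-statistical for $f$ is a Baire generic subset of $X$.
   Context: A point $x$ is non-statistical for $f$ if the sequence of empirical measures $e_n^f(x)=\frac1n\sum_{i=0}^{n-1}\delta_{f^i(x)}$ does not converge in the weak-$*$ topology on Borel probability measures of $X$. Baire generic means containing a countable intersection of open dense subsets. *)

theory Defs
  imports "HOL-Probability.Probability"
begin

section \<open>Smooth manifolds\<close>

text \<open>
  The model space \<open>\<real>\<^sup>n\<close> is the library's \<^const>\<open>Euclidean_space\<close> \<open>n\<close>, so that the dimension is an
  ordinary natural number and \<open>n = 0\<close> is included. For a subset \<open>V\<close> that is open in it,
  \<open>Ck_on n k V g\<close> says that all partial derivatives of \<open>g\<close> of order at most \<open>k\<close>, in the coordinate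
  directions \<open>i < n\<close>, exist and are continuous on \<open>V\<close>.
\<close>

primrec Ck_on :: "nat \<Rightarrow> nat \<Rightarrow> (nat \<Rightarrow> real) set \<Rightarrow> ((nat \<Rightarrow> real) \<Rightarrow> real) \<Rightarrow> bool" where
  "Ck_on n 0 V g \<longleftrightarrow> continuous_map (subtopology (Euclidean_space n) V) euclideanreal g"
| "Ck_on n (Suc k) V g \<longleftrightarrow>
     continuous_map (subtopology (Euclidean_space n) V) euclideanreal g \<and>
     (\<forall>i<n. \<exists>g'. (\<forall>x\<in>V. ((\<lambda>t. g (x(i := t))) has_real_derivative g' x) (at (x i))) \<and>
                  Ck_on n k V g')"

definition smooth_on :: "nat \<Rightarrow> (nat \<Rightarrow> real) set \<Rightarrow> ((nat \<Rightarrow> real) \<Rightarrow> (nat \<Rightarrow> real)) \<Rightarrow> bool" where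
  "smooth_on n V h \<longleftrightarrow> (\<forall>k. \<forall>j<n. Ck_on n k V (\<lambda>x. h x j))"

definition chart :: "nat \<Rightarrow> 'a::topological_space set \<Rightarrow> ('a \<Rightarrow> nat \<Rightarrow> real) \<Rightarrow> bool" where
  "chart n U \<phi> \<longleftrightarrow> open U \<and> openin (Euclidean_space n) (\<phi> ` U) \<and>
     homeomorphic_map (top_of_set U) (subtopology (Euclidean_space n) (\<phi> ` U)) \<phi>"

text \<open>
  The type \<open>'a\<close> itself is the manifold (without boundary); the Hausdorff property and second
  countability are part of the sort. \<open>\<A>\<close> is a smooth atlas, not necessarily maximal.
  Only the values of a chart map on its domain matter.
\<close>

definition smooth_manifold ::
  "nat \<Rightarrow> ('a::{t2_space, second_countable_topology} set \<times> ('a \<Rightarrow> nat \<Rightarrow> real)) set \<Rightarrow> bool" where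
  "smooth_manifold n \<A> \<longleftrightarrow>
     (\<forall>(U, \<phi>)\<in>\<A>. chart n U \<phi>) \<and>
     (\<Union>(U, \<phi>)\<in>\<A>. U) = UNIV \<and>
     (\<forall>(U, \<phi>)\<in>\<A>. \<forall>(V, \<psi>)\<in>\<A>. smooth_on n (\<phi> ` (U \<inter> V)) (\<lambda>x. \<psi> (inv_into U \<phi> x)))"


section \<open>Minimality and unique ergodicity\<close>

definition minimal_map :: "('a::topological_space \<Rightarrow> 'a) \<Rightarrow> bool" where
  "minimal_map f \<longleftrightarrow> (\<forall>x. closure (range (\<lambda>n. (f ^^ n) x)) = UNIV)"

definition borel_probability_measures :: "'a::topological_space measure set" where
  "borel_probability_measures = {\<mu>. sets \<mu> = sets borel \<and> prob_space \<mu>}"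

definition uniquely_ergodic :: "('a::topological_space \<Rightarrow> 'a) \<Rightarrow> bool" where
  "uniquely_ergodic f \<longleftrightarrow> (\<exists>!\<mu>. \<mu> \<in> borel_probability_measures \<and> distr \<mu> borel f = \<mu>)"


section \<open>Non-statistical points\<close>

text \<open>
  The coarsest topology on the Borel probability measures for which all maps
  \<open>\<mu> \<mapsto> \<integral> \<phi> d\<mu>\<close>, \<open>\<phi>\<close> continuous, are continuous. It is only used on compact spaces, where continuous
  test functions are automatically bounded.
\<close>

definition weak_star_topology :: "'a::topological_space measure topology" where
  "weak_star_topology = topology_generated_by
     {{\<mu> \<in> borel_probability_measures. integral\<^sup>L \<mu> \<phi> \<in> W} | \<phi> W.
        continuous_on UNIV (\<phi> :: 'a \<Rightarrow> real) \<and> open W}"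

text \<open>
  For \<open>n = 0\<close> the following is the null measure, which is irrelevant for limits as \<open>n\<close> tends to
  infinity.
\<close>

definition empirical_measure ::
  "('a::topological_space \<Rightarrow> 'a) \<Rightarrow> 'a \<Rightarrow> nat \<Rightarrow> 'a measure" where
  "empirical_measure f x n = measure_of UNIV (sets borel)
     (\<lambda>B. (\<Sum>i<n. emeasure (return borel ((f ^^ i) x)) B) / of_nat n)"

definition non_statistical :: "('a::topological_space \<Rightarrow> 'a) \<Rightarrow> 'a \<Rightarrow> bool" where
  "non_statistical f x \<longleftrightarrow>
     \<not> (\<exists>\<mu>. limitin weak_star_topology (empirical_measure f x) \<mu> sequentially)"

definition baire_generic :: "'a::topological_space set \<Rightarrow> bool" where
  "baire_generic S \<longleftrightarrow>
     (\<exists>\<U>. countable \<U> \<and> (\<forall>U\<in>\<U>. open U \<and> closure U = UNIV) \<and> \<Inter>\<U> \<subseteq> S)"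


section \<open>Basic facts\<close>

lemma sets_empirical_measure [simp]: "sets (empirical_measure f x n) = sets borel"
  unfolding empirical_measure_def using sets.sigma_sets_eq[of borel] by simp

text \<open>The set function defining the empirical measure is indeed a measure.\<close>

lemma emeasure_empirical_measure:
  assumes "B \<in> sets borel"
  shows "emeasure (empirical_measure f x n) B =
           (\<Sum>i<n. emeasure (return borel ((f ^^ i) x)) B) / of_nat n"
proof (rule emeasure_measure_of[OF empirical_measure_def])
  show "countably_additive (sets (empirical_measure f x n))
          (\<lambda>B. (\<Sum>i<n. emeasure (return borel ((f ^^ i) x)) B) / of_nat n)"
  proof (rule countably_additiveI)
    fix A :: "nat \<Rightarrow> 'a set"
    assume A: "range A \<subseteq> sets (empirical_measure f x n)" "disjoint_family A"
    have "(\<Sum>j. (\<Sum>i<n. emeasure (return borel ((f ^^ i) x)) (A j)) / of_nat n) =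
          (\<Sum>i<n. \<Sum>j. emeasure (return borel ((f ^^ i) x)) (A j)) / of_nat n"
      by (simp add: suminf_sum)
    also have "\<dots> = (\<Sum>i<n. emeasure (return borel ((f ^^ i) x)) (\<Union>(range A))) / of_nat n"
      using A by (intro arg_cong2[where f = "(/)"] sum.cong refl suminf_emeasure) auto
    finally show "(\<Sum>j. (\<Sum>i<n. emeasure (return borel ((f ^^ i) x)) (A j)) / of_nat n) =
          (\<Sum>i<n. emeasure (return borel ((f ^^ i) x)) (\<Union>(range A))) / of_nat n" .
  qed
qed (use assms in \<open>auto simp: positive_def\<close>)

lemma empirical_measure_in_borel_probability_measures:
  assumes "n > 0"
  shows "empirical_measure f x n \<in> borel_probability_measures"
proof -
  have "space (empirical_measure f x n) = UNIV"
    by (simp add: empirical_measure_def space_measure_of_conv)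
  then have "emeasure (empirical_measure f x n) (space (empirical_measure f x n)) = 1"
    using assms by (simp add: emeasure_empirical_measure ennreal_divide_self of_nat_less_top)
  then show ?thesis
    by (auto simp: borel_probability_measures_def intro: prob_spaceI)
qed

lemma topspace_weak_star_topology [simp]:
  "topspace weak_star_topology = borel_probability_measures"
proof -
  have "borel_probability_measures \<in> {{\<mu> \<in> borel_probability_measures. integral\<^sup>L \<mu> \<phi> \<in> W} | \<phi> W.
        continuous_on UNIV (\<phi> :: 'a \<Rightarrow> real) \<and> open W}"
    by (rule CollectI, rule exI[of _ "\<lambda>_. 0"], rule exI[of _ UNIV]) auto
  then show ?thesis
    unfolding weak_star_topology_def topology_generated_by_topspace by blast
qed

end

theory Submission
  imports Defs
begin

text \<open>
  If \<open>f\<close> has no invariant Borel probability measure, every point is non-statistical, because a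
  weak-* limit of empirical measures is invariant
  (\<open>limit_of_empirical_measures_invariant\<close>). So failure of unique ergodicity leaves only the case
  of two distinct invariant measures \<open>\<mu>\<close> and \<open>\<nu>\<close>.

  Continuous functions separate Borel probability measures
  (\<open>borel_probability_measure_eqI\<close>), so
  \<open>\<integral> \<phi> d\<mu> < a < b < \<integral> \<phi> d\<nu>\<close> for some continuous \<open>\<phi>\<close> and reals \<open>a < b\<close>. Integrating the Birkhoff
  averages \<open>A\<^sub>n \<phi>\<close> against \<open>\<mu>\<close> produces, for every \<open>n\<close>, a point where \<open>A\<^sub>n \<phi>\<close> is at most the
  integral. By minimality and compactness there is a uniform bound \<open>K\<close> such that every orbit visits
  a given non-empty open set before time \<open>K\<close>, and moving along an orbit by at most \<open>K\<close> steps changes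
  \<open>A\<^sub>n \<phi>\<close> by \<open>O(K / n)\<close>. Hence the open set of points with \<open>A\<^sub>n \<phi> < a\<close> for some \<open>n \<ge> N\<close> is dense
  (\<open>closure_small_birkhoff_averages\<close>). The same holds with \<open>A\<^sub>n \<phi> > b\<close>, by passing to \<open>-\<phi>\<close> and \<open>\<nu>\<close>.
  A point in all of these countably many sets has divergent averages \<open>A\<^sub>n \<phi>\<close>, and so is
  non-statistical.
\<close>

section \<open>Continuous test functions on compact spaces\<close>

lemma continuous_bounded:
  fixes \<phi> :: "'a::topological_space \<Rightarrow> real"
  assumes "compact (UNIV :: 'a set)" "continuous_on UNIV \<phi>"
  obtains B where "B > 0" "\<And>x. \<bar>\<phi> x\<bar> \<le> B"
proof -
  have "bounded (range \<phi>)"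
    using assms compact_continuous_image compact_imp_bounded by blast
  then show ?thesis
    using that unfolding bounded_pos by auto
qed

lemma integrable_continuous:
  fixes \<phi> :: "'a::topological_space \<Rightarrow> real"
  assumes "compact (UNIV :: 'a set)" "continuous_on UNIV \<phi>" "\<mu> \<in> borel_probability_measures"
  shows "integrable \<mu> \<phi>"
proof -
  have sets: "sets \<mu> = sets borel"
    using assms(3) by (simp add: borel_probability_measures_def)
  interpret prob_space \<mu>
    using assms(3) by (simp add: borel_probability_measures_def)
  obtain B where "\<And>x. \<bar>\<phi> x\<bar> \<le> B"
    using continuous_bounded[OF assms(1,2)] by metis
  moreover have "\<phi> \<in> borel_measurable \<mu>"
    using borel_measurable_continuous_onI[OF assms(2)] measurable_cong_sets[OF sets refl] by blast
  ultimately show ?thesis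
    by (intro integrable_const_bound[where B = B]) auto
qed

text \<open>
  The complement of \<open>C\<close> is covered by the open sets \<open>{g > 0}\<close>, where \<open>g\<close> is a Urysohn function
  vanishing on \<open>C\<close>. By the Lindelof property countably many \<open>g\<^sub>0, g\<^sub>1, \<dots>\<close> suffice, and the functions
  \<open>\<Prod>i<m. (1 - g\<^sub>i) ^ m\<close> converge to the indicator function of \<open>C\<close>: the power \<open>m\<close> drives every
  factor that is smaller than \<open>1\<close> to \<open>0\<close>.
\<close>

lemma closed_indicator_limit_continuous:
  fixes C :: "'a::{t2_space, second_countable_topology} set"
  assumes cpt: "compact (UNIV :: 'a set)" and C: "closed C"
  obtains \<phi> :: "nat \<Rightarrow> 'a \<Rightarrow> real"
  where "\<And>m. continuous_on UNIV (\<phi> m)" "\<And>m x. \<bar>\<phi> m x\<bar> \<le> 1"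
        "\<And>x. (\<lambda>m. \<phi> m x) \<longlonglongrightarrow> indicator C x"
proof -
  have "Hausdorff_space (euclidean :: 'a topology)"
    unfolding Hausdorff_space_def disjnt_def using hausdorff by fastforce
  then have normal: "normal_space (euclidean :: 'a topology)"
    using cpt by (intro compact_Hausdorff_or_regular_imp_normal_space) (auto simp: compact_space_def)
  define G where "G = {g :: 'a \<Rightarrow> real. continuous_on UNIV g \<and> range g \<subseteq> {0..1} \<and> (\<forall>x\<in>C. g x = 0)}"
  have urysohn: "\<exists>g\<in>G. g y > 0" if "y \<notin> C" for y
  proof -
    have "closedin euclidean C" "closedin euclidean {y}" "disjnt C {y}" "(0::real) \<le> 1"
      using C that by auto
    from Urysohn_lemma[OF normal this] obtain g
      where "continuous_map euclidean (top_of_set {0..1::real}) g" "g ` C \<subseteq> {0}" "g ` {y} \<subseteq> {1}" .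
    then show ?thesis
      unfolding G_def by (intro bexI[of _ g]) (auto simp: continuous_map_in_subtopology)
  qed
  have "open {x. g x > 0}" if "g \<in> G" for g
    using that open_Collect_less[OF continuous_on_const, of g 0] unfolding G_def by simp
  then have "open S" if "S \<in> (\<lambda>g. {x. g x > 0}) ` G" for S
    using that by auto
  from Lindelof[OF this] obtain \<F>' where \<F>': "\<F>' \<subseteq> (\<lambda>g. {x. g x > 0}) ` G" "countable \<F>'"
    "\<Union>\<F>' = (\<Union>g\<in>G. {x. g x > 0})" .
  then obtain H0 where H0: "H0 \<subseteq> G" "countable H0" "\<F>' = (\<lambda>g. {x. g x > 0}) ` H0"
    using countable_subset_image[of \<F>' "\<lambda>g. {x. g x > 0}" G] by auto
  \<comment> \<open>The zero function makes the family non-empty, which is needed for the enumeration when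
    \<open>C\<close> is the whole space.\<close>
  define H where "H = insert (\<lambda>_. 0) H0"
  define g where "g = from_nat_into H"
  have "countable H" "H \<noteq> {}" "H \<subseteq> G"
    using H0 unfolding H_def G_def by auto
  then have range_g: "range g = H" and gG: "g i \<in> G" for i
    unfolding g_def using range_from_nat_into[of H] from_nat_into[of H i] by auto
  have cont: "continuous_on UNIV (g i)" and g01: "0 \<le> g i x" "g i x \<le> 1"
    and gC: "x \<in> C \<Longrightarrow> g i x = 0" for i x
    using gG[of i] unfolding G_def by (auto simp: image_subset_iff)
  define \<phi> where "\<phi> = (\<lambda>m x. \<Prod>i<m. (1 - g i x) ^ m)"
  have nonneg: "0 \<le> \<phi> m x" for m x
    unfolding \<phi>_def using g01 by (intro prod_nonneg) auto
  have le1: "\<phi> m x \<le> 1" for m x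
    unfolding \<phi>_def using g01 by (intro prod_le_1) (auto intro: power_le_one)
  have "(\<lambda>m. \<phi> m x) \<longlonglongrightarrow> indicator C x" for x
  proof (cases "x \<in> C")
    case True
    then show ?thesis by (simp add: \<phi>_def gC)
  next
    case False
    then have "x \<in> \<Union>\<F>'"
      using urysohn \<F>'(3) by blast
    then obtain h where "h \<in> H" "h x > 0"
      using H0(3) unfolding H_def by auto
    then obtain j where j: "g j x > 0"
      using range_g by (metis rangeE)
    have power: "(\<lambda>m. (1 - g j x) ^ m) \<longlonglongrightarrow> 0"
      using j g01(2)[of j x] by (intro LIMSEQ_realpow_zero) auto
    have le: "\<phi> m x \<le> (1 - g j x) ^ m" if "m > j" for m
    proof -
      have "\<phi> m x = (1 - g j x) ^ m * (\<Prod>i\<in>{..<m} - {j}. (1 - g i x) ^ m)"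
        unfolding \<phi>_def using that by (intro prod.remove) auto
      also have "\<dots> \<le> (1 - g j x) ^ m * 1"
        using g01 by (intro mult_left_mono prod_le_1) (auto intro: power_le_one)
      finally show ?thesis by simp
    qed
    have "\<forall>\<^sub>F m in sequentially. 0 \<le> \<phi> m x"
      using nonneg by simp
    moreover have "\<forall>\<^sub>F m in sequentially. \<phi> m x \<le> (1 - g j x) ^ m"
      using eventually_gt_at_top[of j] by eventually_elim (rule le)
    ultimately have "(\<lambda>m. \<phi> m x) \<longlonglongrightarrow> 0"
      by (rule tendsto_sandwich[OF _ _ tendsto_const power])
    then show ?thesis using False by simp
  qed
  moreover have "continuous_on UNIV (\<phi> m)" for m
    unfolding \<phi>_def by (intro continuous_intros cont)
  moreover have "\<bar>\<phi> m x\<bar> \<le> 1" for m x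
    using nonneg le1 by simp
  ultimately show ?thesis using that by blast
qed

text \<open>
  By dominated convergence the approximations above determine the measure of every closed set, and
  the closed sets form an intersection-stable generator of the Borel sets.
\<close>

lemma borel_probability_measure_eqI:
  fixes \<mu> \<nu> :: "'a::{t2_space, second_countable_topology} measure"
  assumes cpt: "compact (UNIV :: 'a set)"
    and \<mu>: "\<mu> \<in> borel_probability_measures" and \<nu>: "\<nu> \<in> borel_probability_measures"
    and eq: "\<And>\<phi> :: 'a \<Rightarrow> real. continuous_on UNIV \<phi> \<Longrightarrow> integral\<^sup>L \<mu> \<phi> = integral\<^sup>L \<nu> \<phi>"
  shows "\<mu> = \<nu>"
proof (rule measure_eqI_generator_eq[where E = "Collect closed" and \<Omega> = UNIV and A = "\<lambda>_. UNIV"])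
  have sets: "sets borel = sigma_sets UNIV (Collect closed :: 'a set set)"
    by (subst borel_eq_closed) simp
  show "sets \<mu> = sigma_sets UNIV (Collect closed)" "sets \<nu> = sigma_sets UNIV (Collect closed)"
    using \<mu> \<nu> sets by (simp_all add: borel_probability_measures_def)
  show "Int_stable (Collect closed :: 'a set set)"
    by (auto simp: Int_stable_def)
  show "emeasure \<mu> UNIV \<noteq> \<infinity>"
    using \<mu> by (simp add: borel_probability_measures_def prob_space_def finite_measure.emeasure_finite)
  fix C :: "'a set"
  assume "C \<in> Collect closed"
  then obtain \<phi> :: "nat \<Rightarrow> 'a \<Rightarrow> real" where \<phi>: "\<And>m. continuous_on UNIV (\<phi> m)"
    "\<And>m x. \<bar>\<phi> m x\<bar> \<le> 1" "\<And>x. (\<lambda>m. \<phi> m x) \<longlonglongrightarrow> indicator C x" and C: "closed C"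
    using closed_indicator_limit_continuous[OF cpt] by auto
  have lim: "(\<lambda>m. integral\<^sup>L \<rho> (\<phi> m)) \<longlonglongrightarrow> measure \<rho> C"
    if \<rho>: "\<rho> \<in> borel_probability_measures" for \<rho>
  proof -
    have sets_\<rho>: "sets \<rho> = sets borel" and "prob_space \<rho>"
      using \<rho> by (auto simp: borel_probability_measures_def)
    then interpret prob_space \<rho> by simp
    have "space \<rho> = UNIV"
      using sets_eq_imp_space_eq[OF sets_\<rho>] by simp
    moreover have "C \<in> sets \<rho>"
      using C sets_\<rho> by simp
    moreover have "(\<lambda>m. integral\<^sup>L \<rho> (\<phi> m)) \<longlonglongrightarrow> integral\<^sup>L \<rho> (indicator C)"
    proof (rule integral_dominated_convergence[where w = "\<lambda>_. 1"])
      show "(indicator C :: 'a \<Rightarrow> real) \<in> borel_measurable \<rho>"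
        using \<open>C \<in> sets \<rho>\<close> by simp
      show "\<phi> m \<in> borel_measurable \<rho>" for m
        using integrable_continuous[OF cpt \<phi>(1) \<rho>] by blast
    qed (use \<phi> in auto)
    ultimately show ?thesis by simp
  qed
  have "measure \<mu> C = measure \<nu> C"
    using lim[OF \<mu>] lim[OF \<nu>] eq[OF \<phi>(1)] LIMSEQ_unique by simp
  then show "emeasure \<mu> C = emeasure \<nu> C"
    using \<mu> \<nu> by (simp add: borel_probability_measures_def prob_space_def
        finite_measure.emeasure_eq_measure)
qed auto


section \<open>Birkhoff averages and empirical measures\<close>

definition birkhoff_average ::
  "('a \<Rightarrow> 'a) \<Rightarrow> ('a \<Rightarrow> real) \<Rightarrow> nat \<Rightarrow> 'a \<Rightarrow> real" where
  "birkhoff_average f \<phi> n x = (\<Sum>i<n. \<phi> ((f ^^ i) x)) / n"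

lemma birkhoff_average_uminus:
  "birkhoff_average f (\<lambda>x. - \<phi> x) n x = - birkhoff_average f \<phi> n x"
  by (simp add: birkhoff_average_def sum_negf)

lemma continuous_funpow:
  fixes f :: "'a::topological_space \<Rightarrow> 'a"
  assumes "continuous_on UNIV f"
  shows "continuous_on UNIV (f ^^ k)"
proof (induction k)
  case (Suc k)
  then show ?case
    using continuous_on_compose[of UNIV "f ^^ k" f] continuous_on_subset[OF assms]
    by (simp add: o_def)
qed (simp add: id_def)

lemma continuous_birkhoff_average:
  assumes "continuous_on UNIV f" "continuous_on UNIV \<phi>"
  shows "continuous_on UNIV (birkhoff_average f \<phi> n)"
proof -
  have "continuous_on UNIV (\<lambda>x. \<phi> ((f ^^ i) x))" for i
    using continuous_on_compose2[OF assms(2) continuous_funpow[OF assms(1)]] by simp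
  then show ?thesis
    unfolding birkhoff_average_def divide_inverse by (intro continuous_intros)
qed

text \<open>
  For a single step the two sums telescope to a difference of two values of \<open>\<phi>\<close>, divided by \<open>n\<close>.
\<close>

lemma birkhoff_average_funpow:
  assumes B: "\<And>x. \<bar>\<phi> x\<bar> \<le> B"
  shows "\<bar>birkhoff_average f \<phi> n ((f ^^ k) x) - birkhoff_average f \<phi> n x\<bar> \<le> 2 * B * k / n"
proof (induction k)
  case (Suc k)
  let ?y = "(f ^^ k) x"
  have "(\<Sum>i<n. \<phi> ((f ^^ i) (f ?y))) = (\<Sum>i<n. \<phi> ((f ^^ Suc i) ?y))"
    by (simp add: funpow_swap1)
  then have "birkhoff_average f \<phi> n (f ?y) - birkhoff_average f \<phi> n ?y
      = (\<Sum>i<n. \<phi> ((f ^^ Suc i) ?y) - \<phi> ((f ^^ i) ?y)) / n"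
    by (simp add: birkhoff_average_def sum_subtractf diff_divide_distrib)
  also have "\<dots> = (\<phi> ((f ^^ n) ?y) - \<phi> ?y) / n"
    using sum_lessThan_telescope[of "\<lambda>i. \<phi> ((f ^^ i) ?y)" n] by simp
  finally have "\<bar>birkhoff_average f \<phi> n (f ?y) - birkhoff_average f \<phi> n ?y\<bar>
      = \<bar>\<phi> ((f ^^ n) ?y) - \<phi> ?y\<bar> / n"
    by simp
  also have "\<dots> \<le> 2 * B / n"
    using B[of "(f ^^ n) ?y"] B[of ?y] by (intro divide_right_mono) auto
  finally have "\<bar>birkhoff_average f \<phi> n (f ?y) - birkhoff_average f \<phi> n x\<bar>
      \<le> 2 * B * k / n + 2 * B / n"
    using Suc.IH by linarith
  then show ?case
    by (simp add: algebra_simps add_divide_distrib)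
qed simp

text \<open>
  As the image of the uniform distribution on \<open>{..<n}\<close> under \<open>i \<mapsto> f\<^sup>i(x)\<close>, the empirical measure
  has integrals that are finite averages.
\<close>

lemma empirical_measure_eq_distr:
  assumes "n > 0"
  shows "empirical_measure f x n = distr (measure_pmf (pmf_of_set {..<n})) borel (\<lambda>i. (f ^^ i) x)"
proof (rule measure_eqI)
  fix B
  assume "B \<in> sets (empirical_measure f x n)"
  then have B: "B \<in> sets borel" by simp
  have ne: "{..<n} \<noteq> {}" using assms by auto
  have "(\<Sum>i<n. emeasure (return borel ((f ^^ i) x)) B) = (\<Sum>i<n. indicator B ((f ^^ i) x))"
    using B by simp
  also have "\<dots> = of_nat (card ({..<n} \<inter> {i. (f ^^ i) x \<in> B}))"
    by (simp add: indicator_def sum.If_cases)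
  finally show "emeasure (empirical_measure f x n) B =
      emeasure (distr (measure_pmf (pmf_of_set {..<n})) borel (\<lambda>i. (f ^^ i) x)) B"
    using B assms ne
    by (simp add: emeasure_empirical_measure emeasure_distr emeasure_pmf_of_set vimage_def
        divide_ennreal[symmetric] ennreal_of_nat_eq_real_of_nat)
qed simp

lemma integral_empirical_measure:
  assumes "n > 0" "\<phi> \<in> borel_measurable borel"
  shows "integral\<^sup>L (empirical_measure f x n) \<phi> = birkhoff_average f \<phi> n x"
proof -
  have "{..<n} \<noteq> {}" using assms by auto
  then show ?thesis
    using assms by (simp add: empirical_measure_eq_distr integral_distr integral_pmf_of_set
        birkhoff_average_def)
qed

lemma limitin_weak_star_topologyD:
  assumes lim: "limitin weak_star_topology (empirical_measure f x) \<mu> sequentially"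
    and \<phi>: "continuous_on UNIV \<phi>"
  shows "(\<lambda>n. birkhoff_average f \<phi> n x) \<longlonglongrightarrow> integral\<^sup>L \<mu> \<phi>"
proof (rule topological_tendstoI)
  fix W :: "real set"
  assume W: "open W" "integral\<^sup>L \<mu> \<phi> \<in> W"
  let ?V = "{\<nu> \<in> borel_probability_measures. integral\<^sup>L \<nu> \<phi> \<in> W}"
  have "openin weak_star_topology ?V"
    unfolding weak_star_topology_def by (rule topology_generated_by_Basis) (use W \<phi> in blast)
  moreover have "\<mu> \<in> ?V"
    using lim W by (auto simp: limitin_def)
  ultimately have "\<forall>\<^sub>F n in sequentially. empirical_measure f x n \<in> ?V"
    using lim unfolding limitin_def by blast
  then show "\<forall>\<^sub>F n in sequentially. birkhoff_average f \<phi> n x \<in> W"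
    using eventually_gt_at_top[of 0]
    by eventually_elim
      (use integral_empirical_measure[OF _ borel_measurable_continuous_onI[OF \<phi>]] in auto)
qed


section \<open>Invariant measures\<close>

lemma integral_invariant:
  fixes \<phi> :: "'a::topological_space \<Rightarrow> real"
  assumes \<mu>: "\<mu> \<in> borel_probability_measures" "distr \<mu> borel f = \<mu>"
    and f: "continuous_on UNIV f" and \<phi>: "continuous_on UNIV \<phi>"
  shows "(\<integral>x. \<phi> ((f ^^ i) x) \<partial>\<mu>) = integral\<^sup>L \<mu> \<phi>"
proof (induction i)
  case (Suc i)
  have sets: "sets \<mu> = sets borel"
    using \<mu> by (simp add: borel_probability_measures_def)
  have f_meas: "f \<in> measurable \<mu> borel"
    using borel_measurable_continuous_onI[OF f] measurable_cong_sets[OF sets refl] by blast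
  have "(\<lambda>x. \<phi> ((f ^^ i) x)) \<in> borel_measurable borel"
    by (intro borel_measurable_continuous_onI continuous_on_compose2[OF \<phi> continuous_funpow[OF f]])
      simp
  from integral_distr[OF f_meas this]
  have "(\<integral>x. \<phi> ((f ^^ i) (f x)) \<partial>\<mu>) = (\<integral>x. \<phi> ((f ^^ i) x) \<partial>distr \<mu> borel f)" ..
  then show ?case
    using Suc.IH \<mu>(2) by (simp add: funpow_swap1)
qed simp

text \<open>
  The averages of \<open>\<phi> \<circ> f\<close> and of \<open>\<phi>\<close> along an orbit differ by \<open>O(1/n)\<close>, so the limit measure gives
  \<open>\<phi> \<circ> f\<close> and \<open>\<phi>\<close> the same integral.
\<close>

lemma limit_of_empirical_measures_invariant:
  fixes f :: "'a::{t2_space, second_countable_topology} \<Rightarrow> 'a"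
  assumes cpt: "compact (UNIV :: 'a set)" and f: "continuous_on UNIV f"
    and lim: "limitin weak_star_topology (empirical_measure f x) \<mu> sequentially"
  shows "\<mu> \<in> borel_probability_measures" "distr \<mu> borel f = \<mu>"
proof -
  show \<mu>: "\<mu> \<in> borel_probability_measures"
    using lim by (simp add: limitin_def)
  then have sets: "sets \<mu> = sets borel"
    by (simp add: borel_probability_measures_def)
  have f_meas: "f \<in> measurable \<mu> borel"
    using borel_measurable_continuous_onI[OF f] measurable_cong_sets[OF sets refl] by blast
  show "distr \<mu> borel f = \<mu>"
  proof (rule borel_probability_measure_eqI[OF cpt _ \<mu>])
    show "distr \<mu> borel f \<in> borel_probability_measures"
      using \<mu> f_meas by (auto simp: borel_probability_measures_def intro: prob_space.prob_space_distr)
    fix \<phi> :: "'a \<Rightarrow> real"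
    assume \<phi>: "continuous_on UNIV \<phi>"
    obtain B where B: "\<And>x. \<bar>\<phi> x\<bar> \<le> B"
      using continuous_bounded[OF cpt \<phi>] by metis
    have \<phi>f: "continuous_on UNIV (\<lambda>x. \<phi> (f x))"
      using continuous_on_compose2[OF \<phi> f] by simp
    have shift: "birkhoff_average f (\<lambda>x. \<phi> (f x)) n x = birkhoff_average f \<phi> n (f x)" for n
      by (simp add: birkhoff_average_def funpow_swap1)
    have "(\<lambda>n. birkhoff_average f \<phi> n (f x) - birkhoff_average f \<phi> n x) \<longlonglongrightarrow> 0"
    proof (rule Lim_null_comparison)
      show "\<forall>\<^sub>F n in sequentially.
          norm (birkhoff_average f \<phi> n (f x) - birkhoff_average f \<phi> n x) \<le> 2 * B / real n"
        using birkhoff_average_funpow[where k = 1 and f = f and x = x, OF B] by simp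
      show "(\<lambda>n. 2 * B / real n) \<longlonglongrightarrow> 0"
        by (rule lim_const_over_n)
    qed
    then have "(\<lambda>n. birkhoff_average f \<phi> n x + (birkhoff_average f \<phi> n (f x) - birkhoff_average f \<phi> n x))
        \<longlonglongrightarrow> integral\<^sup>L \<mu> \<phi> + 0"
      by (intro tendsto_add limitin_weak_star_topologyD[OF lim \<phi>])
    then have "(\<lambda>n. birkhoff_average f \<phi> n (f x)) \<longlonglongrightarrow> integral\<^sup>L \<mu> \<phi>"
      by simp
    moreover have "(\<lambda>n. birkhoff_average f \<phi> n (f x)) \<longlonglongrightarrow> (\<integral>x. \<phi> (f x) \<partial>\<mu>)"
      using limitin_weak_star_topologyD[OF lim \<phi>f] by (simp add: shift)
    ultimately have "(\<integral>x. \<phi> (f x) \<partial>\<mu>) = integral\<^sup>L \<mu> \<phi>"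
      using LIMSEQ_unique by blast
    then show "integral\<^sup>L (distr \<mu> borel f) \<phi> = integral\<^sup>L \<mu> \<phi>"
      using integral_distr[OF f_meas borel_measurable_continuous_onI[OF \<phi>]] by simp
  qed
qed

text \<open>
  The integral of the average against an invariant measure is the integral of \<open>\<phi>\<close>, so the average
  cannot be \<open>\<ge> a\<close> everywhere.
\<close>

lemma exists_small_birkhoff_average:
  fixes \<phi> :: "'a::topological_space \<Rightarrow> real"
  assumes cpt: "compact (UNIV :: 'a set)"
    and \<mu>: "\<mu> \<in> borel_probability_measures" "distr \<mu> borel f = \<mu>"
    and f: "continuous_on UNIV f" and \<phi>: "continuous_on UNIV \<phi>"
    and a: "integral\<^sup>L \<mu> \<phi> < a" and n: "n > 0"
  shows "\<exists>x. birkhoff_average f \<phi> n x < a"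
proof (rule ccontr)
  assume "\<nexists>x. birkhoff_average f \<phi> n x < a"
  then have ge: "\<And>x. a \<le> birkhoff_average f \<phi> n x"
    by (simp add: not_less)
  interpret prob_space \<mu>
    using \<mu>(1) by (simp add: borel_probability_measures_def)
  have int: "integrable \<mu> (\<lambda>x. \<phi> ((f ^^ i) x))" for i
    by (rule integrable_continuous[OF cpt _ \<mu>(1)],
        rule continuous_on_compose2[OF \<phi> continuous_funpow[OF f]]) simp
  have "a = (\<integral>x. a \<partial>\<mu>)"
    by (simp add: prob_space)
  also have "\<dots> \<le> integral\<^sup>L \<mu> (birkhoff_average f \<phi> n)"
    using ge by (intro integral_mono integrable_continuous[OF cpt _ \<mu>(1)]
        continuous_birkhoff_average f \<phi>) auto
  also have "\<dots> = (\<Sum>i<n. \<integral>x. \<phi> ((f ^^ i) x) \<partial>\<mu>) / n"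
    using int by (simp add: birkhoff_average_def[abs_def])
  also have "\<dots> = integral\<^sup>L \<mu> \<phi>"
    using n by (simp add: integral_invariant[OF \<mu> f \<phi>])
  finally show False using a by simp
qed


section \<open>Minimality and density\<close>

text \<open>
  Since all orbits are dense, the open preimages of \<open>W\<close> under the iterates of \<open>f\<close> cover the space;
  a finite subcover bounds the visiting time uniformly.
\<close>

lemma minimal_uniform_visiting_time:
  fixes f :: "'a::topological_space \<Rightarrow> 'a"
  assumes cpt: "compact (UNIV :: 'a set)" and f: "continuous_on UNIV f" and min: "minimal_map f"
    and W: "open W" "W \<noteq> {}"
  obtains K where "\<And>x. \<exists>k<K. (f ^^ k) x \<in> W"
proof -
  have visit: "\<exists>k. (f ^^ k) x \<in> W" for x
  proof -
    have "closure (range (\<lambda>n. (f ^^ n) x)) = UNIV"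
      using min by (simp add: minimal_map_def)
    then show ?thesis
      using open_Int_closure_eq_empty[OF W(1), of "range (\<lambda>n. (f ^^ n) x)"] W(2) by auto
  qed
  have "open ((f ^^ k) -` W)" for k
    using open_vimage[OF W(1) continuous_funpow[OF f]] .
  moreover have "UNIV \<subseteq> (\<Union>k\<in>UNIV. (f ^^ k) -` W)"
    using visit by auto
  ultimately obtain I where I: "finite I" "UNIV \<subseteq> (\<Union>k\<in>I. (f ^^ k) -` W)"
    by (rule compactE_image[OF cpt, of UNIV "\<lambda>k. (f ^^ k) -` W"]) auto
  obtain K where "\<forall>k\<in>I. k < K"
    using I(1) finite_nat_set_iff_bounded by blast
  then show ?thesis
    using I(2) by (intro that[of K]) blast
qed

text \<open>
  Some point has a small average over a long time \<open>n\<close>. Within bounded time its orbit enters the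
  prescribed open set, and for large \<open>n\<close> the average is still small there.
\<close>

lemma closure_small_birkhoff_averages:
  fixes \<phi> :: "'a::topological_space \<Rightarrow> real"
  assumes cpt: "compact (UNIV :: 'a set)" and f: "continuous_on UNIV f" and min: "minimal_map f"
    and \<mu>: "\<mu> \<in> borel_probability_measures" "distr \<mu> borel f = \<mu>"
    and \<phi>: "continuous_on UNIV \<phi>" and a: "integral\<^sup>L \<mu> \<phi> < a"
  shows "closure {x. \<exists>n\<ge>N. birkhoff_average f \<phi> n x < a} = UNIV"
proof -
  have "\<exists>y\<in>W. \<exists>n\<ge>N. birkhoff_average f \<phi> n y < a" if W: "open W" "W \<noteq> {}" for W
  proof -
    obtain K where K: "\<And>x. \<exists>k<K. (f ^^ k) x \<in> W"
      using minimal_uniform_visiting_time[OF cpt f min W] by metis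
    obtain B where B: "B > 0" "\<And>x. \<bar>\<phi> x\<bar> \<le> B"
      using continuous_bounded[OF cpt \<phi>] by metis
    obtain a' where a': "integral\<^sup>L \<mu> \<phi> < a'" "a' < a"
      using dense[OF a] by blast
    \<comment> \<open>The gap between \<open>a'\<close> and \<open>a\<close> absorbs the error of moving up to \<open>K\<close> steps along an orbit.\<close>
    have "(\<lambda>n. 2 * B * K / real n) \<longlonglongrightarrow> 0"
      by (rule lim_const_over_n)
    then have "\<forall>\<^sub>F n in sequentially. 2 * B * K / real n < a - a'"
      using a'(2) by (intro order_tendstoD(2)[of _ 0]) auto
    then have "\<forall>\<^sub>F n in sequentially. 2 * B * K / real n < a - a' \<and> N \<le> n \<and> 0 < n"
      using eventually_ge_at_top[of N] eventually_gt_at_top[of 0] by eventually_elim auto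
    then obtain n where n: "2 * B * K / real n < a - a'" "N \<le> n" "0 < n"
      using eventually_happens'[OF sequentially_bot] by blast
    obtain x where x: "birkhoff_average f \<phi> n x < a'"
      using exists_small_birkhoff_average[OF cpt \<mu> f \<phi> a'(1) n(3)] by blast
    obtain k where k: "k < K" "(f ^^ k) x \<in> W"
      using K by blast
    have "2 * B * k / n \<le> 2 * B * K / n"
      using k(1) B(1) by (intro divide_right_mono mult_left_mono) auto
    then have "birkhoff_average f \<phi> n ((f ^^ k) x) < a"
      using birkhoff_average_funpow[of \<phi> B f n k x, OF B(2)] x n(1) by linarith
    then show ?thesis
      using k(2) n(2) by blast
  qed
  from this[of "- closure {x. \<exists>n\<ge>N. birkhoff_average f \<phi> n x < a}"] show ?thesis
    using closure_subset[of "{x. \<exists>n\<ge>N. birkhoff_average f \<phi> n x < a}"] by auto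
qed

lemma open_small_birkhoff_averages:
  assumes "continuous_on UNIV f" "continuous_on UNIV \<phi>"
  shows "open {x. \<exists>n\<ge>N. birkhoff_average f \<phi> n x < a}"
proof -
  have "open {x. birkhoff_average f \<phi> n x < a}" for n
    by (intro open_Collect_less continuous_birkhoff_average assms continuous_on_const)
  then have "open (\<Union>n\<in>{N..}. {x. birkhoff_average f \<phi> n x < a})"
    by blast
  moreover have "(\<Union>n\<in>{N..}. {x. birkhoff_average f \<phi> n x < a})
      = {x. \<exists>n\<ge>N. birkhoff_average f \<phi> n x < a}"
    by auto
  ultimately show ?thesis by simp
qed


section \<open>Oscillating averages\<close>

lemma non_statistical_if_oscillating:
  assumes \<phi>: "continuous_on UNIV \<phi>" and ab: "a < b"
    and small: "\<And>N. \<exists>n\<ge>N. birkhoff_average f \<phi> n x < a"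
    and large: "\<And>N. \<exists>n\<ge>N. b < birkhoff_average f \<phi> n x"
  shows "non_statistical f x"
  unfolding non_statistical_def
proof
  assume "\<exists>\<mu>. limitin weak_star_topology (empirical_measure f x) \<mu> sequentially"
  then obtain L where L: "(\<lambda>n. birkhoff_average f \<phi> n x) \<longlonglongrightarrow> L"
    using limitin_weak_star_topologyD[OF _ \<phi>] by blast
  have "L \<le> a"
  proof (rule ccontr)
    assume "\<not> L \<le> a"
    then obtain N where "\<And>n. n \<ge> N \<Longrightarrow> a < birkhoff_average f \<phi> n x"
      using order_tendstoD(1)[OF L, of a] unfolding eventually_sequentially by auto
    then show False
      using small[of N] by force
  qed
  moreover have "b \<le> L"
  proof (rule ccontr)
    assume "\<not> b \<le> L"
    then obtain N where "\<And>n. n \<ge> N \<Longrightarrow> birkhoff_average f \<phi> n x < b"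
      using order_tendstoD(2)[OF L, of b] unfolding eventually_sequentially by auto
    then show False
      using large[of N] by force
  qed
  ultimately show False using ab by simp
qed

lemma generic_if_two_invariant_measures:
  fixes f :: "'a::topological_space \<Rightarrow> 'a" and \<phi> :: "'a \<Rightarrow> real"
  assumes cpt: "compact (UNIV :: 'a set)" and f: "continuous_on UNIV f" and min: "minimal_map f"
    and \<mu>: "\<mu> \<in> borel_probability_measures" "distr \<mu> borel f = \<mu>"
    and \<nu>: "\<nu> \<in> borel_probability_measures" "distr \<nu> borel f = \<nu>"
    and \<phi>: "continuous_on UNIV \<phi>" and less: "integral\<^sup>L \<mu> \<phi> < integral\<^sup>L \<nu> \<phi>"
  shows "baire_generic {x. non_statistical f x}"
proof -
  obtain a where a: "integral\<^sup>L \<mu> \<phi> < a" "a < integral\<^sup>L \<nu> \<phi>"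
    using dense[OF less] by blast
  obtain b where b: "a < b" "b < integral\<^sup>L \<nu> \<phi>"
    using dense[OF a(2)] by blast
  \<comment> \<open>Averages above \<open>b\<close> are averages of \<open>-\<phi>\<close> below \<open>-b\<close>, so the density result applies to both
    sides.\<close>
  have \<phi>': "continuous_on UNIV (\<lambda>x. - \<phi> x)"
    using \<phi> by (rule continuous_on_minus)
  have b': "integral\<^sup>L \<nu> (\<lambda>x. - \<phi> x) < - b"
    using b(2) by simp
  define U where "U N = {x. \<exists>n\<ge>N. birkhoff_average f \<phi> n x < a}" for N :: nat
  define V where "V N = {x. \<exists>n\<ge>N. birkhoff_average f (\<lambda>x. - \<phi> x) n x < - b}" for N :: nat
  have "open (U N)" "open (V N)" for N
    unfolding U_def V_def using open_small_birkhoff_averages f \<phi> \<phi>' by blast+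
  moreover have "closure (U N) = UNIV" "closure (V N) = UNIV" for N
    unfolding U_def V_def using closure_small_birkhoff_averages[OF cpt f min \<mu> \<phi> a(1)]
      closure_small_birkhoff_averages[OF cpt f min \<nu> \<phi>' b'] by auto
  moreover have "x \<in> {x. non_statistical f x}" if "x \<in> \<Inter>(range U \<union> range V)" for x
  proof -
    have "\<exists>n\<ge>N. birkhoff_average f \<phi> n x < a" "\<exists>n\<ge>N. b < birkhoff_average f \<phi> n x" for N
      using that by (auto simp: U_def V_def birkhoff_average_uminus)
    then show ?thesis
      using non_statistical_if_oscillating[OF \<phi> b(1)] by blast
  qed
  ultimately show ?thesis
    unfolding baire_generic_def by (intro exI[of _ "range U \<union> range V"]) auto
qed

theorem corollary1p6:
  fixes f :: "'a::{t2_space, second_countable_topology} \<Rightarrow> 'a"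
    and n :: nat
    and \<A> :: "('a set \<times> ('a \<Rightarrow> nat \<Rightarrow> real)) set"
  assumes "smooth_manifold n \<A>"
    and "compact (UNIV :: 'a set)"
    and "continuous_on UNIV f"
    and "minimal_map f"
    and "\<not> uniquely_ergodic f"
  shows "baire_generic {x. non_statistical f x}"
proof (cases "\<exists>\<mu>. \<mu> \<in> borel_probability_measures \<and> distr \<mu> borel f = \<mu>")
  case False
  then have "{x. non_statistical f x} = UNIV"
    using limit_of_empirical_measures_invariant[OF assms(2,3)] unfolding non_statistical_def by blast
  then show ?thesis
    unfolding baire_generic_def by (intro exI[of _ "{}"]) simp
next
  case True
  then obtain \<mu> \<nu> where \<mu>: "\<mu> \<in> borel_probability_measures" "distr \<mu> borel f = \<mu>"
    and \<nu>: "\<nu> \<in> borel_probability_measures" "distr \<nu> borel f = \<nu>" and "\<mu> \<noteq> \<nu>"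
    using assms(5) unfolding uniquely_ergodic_def by blast
  then obtain \<phi> :: "'a \<Rightarrow> real" where \<phi>: "continuous_on UNIV \<phi>"
    and "integral\<^sup>L \<mu> \<phi> \<noteq> integral\<^sup>L \<nu> \<phi>"
    using borel_probability_measure_eqI[OF assms(2)] by blast
  then consider "integral\<^sup>L \<mu> \<phi> < integral\<^sup>L \<nu> \<phi>" | "integral\<^sup>L \<nu> \<phi> < integral\<^sup>L \<mu> \<phi>"
    by linarith
  then show ?thesis
    using generic_if_two_invariant_measures[OF assms(2-4) \<mu> \<nu> \<phi>]
      generic_if_two_invariant_measures[OF assms(2-4) \<nu> \<mu> \<phi>] by cases
qed

end
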